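(* Let $\mathcal{A}^{\mathbb{Z}}$ be an Abelian group shift, let $(\mathcal{A}^{\mathbb{Z}},F)$ be an algebraic bipermutative cellular automaton and let $\Sigma$ be a closed $(F,\sigma)$-invariant subgroup of $\mathcal{A}^{\mathbb{Z}}$. If $D^\Sigma_1=\mathrm{Ker}(F)\cap\Sigma$ contains no nontrivial $\sigma$-invariant subgroup (i.e. its only $\sigma$-invariant subgroups are $\{0\}$ and $D_1^\Sigma$), then $D^\Sigma_\infty=\bigcup_{n\in\mathbb{N}}\mathrm{Ker}(F^n)\cap\Sigma$ contains no nontrivial $(F,\sigma)$-invariant infinite subgroup (i.e. every $(F,\sigma)$-invariant infinite subgroup of $D^\Sigma_\infty$ equals $D^\Sigma_\infty$).
   Context: $\mathcal{A}$ is a finite set, $\mathcal{A}^{\mathbb{Z}}$ has the product topology, and $\sigma(x)_i=x_{i+1}$ is the shift. A cellular automaton (CA) is a continuous map $F:\mathcal{A}^{\mathbb{Z}}\to\mathcal{A}^{\mathbb{Z}}$ commuting with $\sigma$; equivalently there are a finite interval $\mathbb{U}\subset\mathbb{Z}$ and a local rule $\overline{F}:\mathcal{A}^{\mathbb{U}}\to\mathcal{A}$ with $F(x)_m=\overline{F}((x_{m+u})_{u\in\mathbb{U}})$; the smallest such interval is the smallest neighborhood. With smallest neighborhood $[r,s]$, $F$ is bipermutative if for all $u\in\mathcal{A}^{s-r}$, $b\in\mathcal{A}$ there is a unique $a\in\mathcal{A}$ with $\overline{F}(au)=b$ and a unique $a'\in\mathcal{A}$ with $\overline{F}(ua')=b$.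 $\mathcal{A}^{\mathbb{Z}}$ is an Abelian group shift if it carries an Abelian topological group structure (not necessarily a product structure) for which $\sigma$ is a continuous group endomorphism; a CA on it is algebraic if it is a group endomorphism. A subgroup $\Gamma$ is $\sigma$-invariant if $\sigma(\Gamma)=\Gamma$ and $(F,\sigma)$-invariant if moreover $F(\Gamma)\subset\Gamma$. *)

theory Defs
  imports "HOL-Analysis.Analysis" "HOL-Algebra.Algebra"
begin

definition shift :: "(int \<Rightarrow> 'a) \<Rightarrow> int \<Rightarrow> 'a" where
  "shift x = (\<lambda>i. x (i + 1))"

definition config_topology :: "(int \<Rightarrow> 'a) topology" where
  "config_topology = product_topology (\<lambda>_. discrete_topology UNIV) UNIV"

definition cellular_automaton :: "((int \<Rightarrow> 'a) \<Rightarrow> (int \<Rightarrow> 'a)) \<Rightarrow> bool" where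
  "cellular_automaton F \<longleftrightarrow>
     continuous_map config_topology config_topology F \<and> F \<circ> shift = shift \<circ> F"

text \<open>Words over the alphabet are lists, so a local rule on the interval \<open>[r, s]\<close> is a function
  on lists of which only the values on lists of length \<open>s - r + 1\<close> matter.\<close>

definition local_rule ::
    "((int \<Rightarrow> 'a) \<Rightarrow> (int \<Rightarrow> 'a)) \<Rightarrow> int \<Rightarrow> int \<Rightarrow> ('a list \<Rightarrow> 'a) \<Rightarrow> bool" where
  "local_rule F r s f \<longleftrightarrow> (\<forall>x m. F x m = f (map x [m + r..m + s]))"

definition neighborhood :: "((int \<Rightarrow> 'a) \<Rightarrow> (int \<Rightarrow> 'a)) \<Rightarrow> int \<Rightarrow> int \<Rightarrow> bool" where
  "neighborhood F r s \<longleftrightarrow> r \<le> s \<and> (\<exists>f. local_rule F r s f)"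

text \<open>Intervals are nonempty here; a constant map then has no smallest neighborhood.\<close>

definition smallest_neighborhood :: "((int \<Rightarrow> 'a) \<Rightarrow> (int \<Rightarrow> 'a)) \<Rightarrow> int \<Rightarrow> int \<Rightarrow> bool" where
  "smallest_neighborhood F r s \<longleftrightarrow>
     neighborhood F r s \<and> (\<forall>r' s'. neighborhood F r' s' \<longrightarrow> {r..s} \<subseteq> {r'..s'})"

definition bipermutative :: "((int \<Rightarrow> 'a) \<Rightarrow> (int \<Rightarrow> 'a)) \<Rightarrow> bool" where
  "bipermutative F \<longleftrightarrow>
     (\<exists>r s f. smallest_neighborhood F r s \<and> local_rule F r s f \<and>
        (\<forall>u b. length u = nat (s - r) \<longrightarrow> (\<exists>!a. f (a # u) = b) \<and> (\<exists>!a. f (u @ [a]) = b)))"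

text \<open>The group law is written multiplicatively, following HOL-Algebra.\<close>

definition abelian_group_shift :: "(int \<Rightarrow> 'a) monoid \<Rightarrow> bool" where
  "abelian_group_shift G \<longleftrightarrow>
     comm_group G \<and> carrier G = UNIV \<and>
     continuous_map (prod_topology config_topology config_topology) config_topology
       (\<lambda>(x, y). x \<otimes>\<^bsub>G\<^esub> y) \<and>
     continuous_map config_topology config_topology (\<lambda>x. inv\<^bsub>G\<^esub> x) \<and>
     continuous_map config_topology config_topology (shift :: (int \<Rightarrow> 'a) \<Rightarrow> _) \<and>
     shift \<in> hom G G"

definition algebraic_CA ::
    "(int \<Rightarrow> 'a) monoid \<Rightarrow> ((int \<Rightarrow> 'a) \<Rightarrow> (int \<Rightarrow> 'a)) \<Rightarrow> bool" where
  "algebraic_CA G F \<longleftrightarrow> cellular_automaton F \<and> F \<in> hom G G"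

definition shift_invariant :: "(int \<Rightarrow> 'a) set \<Rightarrow> bool" where
  "shift_invariant \<Gamma> \<longleftrightarrow> shift ` \<Gamma> = \<Gamma>"

definition F_shift_invariant ::
    "((int \<Rightarrow> 'a) \<Rightarrow> (int \<Rightarrow> 'a)) \<Rightarrow> (int \<Rightarrow> 'a) set \<Rightarrow> bool" where
  "F_shift_invariant F \<Gamma> \<longleftrightarrow> shift_invariant \<Gamma> \<and> F ` \<Gamma> \<subseteq> \<Gamma>"

end

theory Submission
  imports Defs
begin

text \<open>Write \<open>D\<^sub>n = Ker(F\<^sup>n) \<inter> \<Sigma>\<close>. Bipermutativity makes every configuration determined by its image
  together with one window of cells, so \<open>Ker(F)\<close>, and hence every \<open>D\<^sub>n\<close>, is finite. For an infinite
  invariant \<open>\<Gamma>\<close> the group \<open>F\<^sup>n(\<Gamma> \<inter> D\<^sub>n\<^sub>+\<^sub>1)\<close> is a \<open>\<sigma>\<close>-invariant subgroup of \<open>D\<^sub>1\<close>. Were it trivial, then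
  \<open>\<Gamma> \<inter> D\<^sub>n\<^sub>+\<^sub>1 \<subseteq> D\<^sub>n\<close>, and pulling back along \<open>F\<close> would give \<open>\<Gamma> \<subseteq> D\<^sub>n\<close>, which is finite. So it is
  all of \<open>D\<^sub>1\<close>, and \<open>D\<^sub>n\<^sub>+\<^sub>1 \<subseteq> \<Gamma>\<close> follows from \<open>D\<^sub>n \<subseteq> \<Gamma>\<close>.\<close>

lemma funpow_hom:
  assumes "F \<in> hom G G"
  shows "F ^^ n \<in> hom G G"
  using assms by (induction n) (auto simp: hom_def Pi_iff)

text \<open>Since \<open>F\<close> fixes the identity, an orbit that reaches it stays there.\<close>

lemma kernel_mono_funpow:
  assumes "group G" and hom: "F \<in> hom G G" and "m \<le> n"
  shows "kernel G G (F ^^ m) \<subseteq> kernel G G (F ^^ n)"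
  using \<open>m \<le> n\<close>
proof (induction rule: dec_induct)
  case (step n)
  have "F \<one>\<^bsub>G\<^esub> = \<one>\<^bsub>G\<^esub>"
    using assms hom_one by blast
  with step.IH show ?case
    by (auto simp: kernel_def)
qed simp

text \<open>By induction, the kernel of \<open>F ^^ Suc n\<close> is covered by the fibres of
  \<open>F\<close> over the finite kernel of \<open>F ^^ n\<close>.\<close>

lemma finite_kernel_funpow:
  assumes "group G" and hom: "F \<in> hom G G" and fin: "\<And>z. finite {x \<in> carrier G. F x = z}"
  shows "finite (kernel G G (F ^^ n))"
proof (induction n)
  case 0
  show ?case
    by (rule finite_subset[of _ "{\<one>\<^bsub>G\<^esub>}"]) (auto simp: kernel_def)
next
  case (Suc n)
  have "kernel G G (F ^^ Suc n) \<subseteq> (\<Union>z \<in> kernel G G (F ^^ n). {x \<in> carrier G. F x = z})"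
    using hom by (auto simp: kernel_def funpow_swap1 hom_def)
  then show ?case
    using Suc fin by (meson finite_UN finite_subset)
qed

text \<open>The purely group-theoretic core. The shift enters only through \<open>minimal\<close>,
  which states the dichotomy for exactly those subgroups of the kernel to which the argument applies
  it.\<close>

lemma kernel_funpow_subset:
  assumes G: "group G" and hom: "F \<in> hom G G" and fin: "\<And>z. finite {x \<in> carrier G. F x = z}"
    and S: "subgroup S G" and SF: "F ` S \<subseteq> S"
    and H: "subgroup H G" "H \<subseteq> S" "F ` H \<subseteq> H" "infinite H"
    and H_nil: "H \<subseteq> (\<Union>n. kernel G G (F ^^ n))"
    and minimal: "\<And>n. (F ^^ n) ` (H \<inter> kernel G G (F ^^ Suc n)) \<subseteq> {\<one>\<^bsub>G\<^esub>} \<or>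
          kernel G G F \<inter> S \<subseteq> (F ^^ n) ` (H \<inter> kernel G G (F ^^ Suc n))"
  shows "kernel G G (F ^^ n) \<inter> S \<subseteq> H"
proof (induction n)
  case 0
  show ?case
    using H(1) by (auto simp: kernel_def subgroup.one_closed)
next
  case (Suc n)
  interpret group G by fact
  let ?K = "\<lambda>n. kernel G G (F ^^ n)"
  have "\<not> (F ^^ n) ` (H \<inter> ?K (Suc n)) \<subseteq> {\<one>\<^bsub>G\<^esub>}"
  proof
    assume triv: "(F ^^ n) ` (H \<inter> ?K (Suc n)) \<subseteq> {\<one>\<^bsub>G\<^esub>}"
    \<comment> \<open>For \<open>x\<close> in \<open>H\<close> killed by \<open>n + Suc k\<close>
      iterates, \<open>F x\<close> is in \<open>H\<close> and killed by \<open>n + k\<close>, hence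
      by \<open>n\<close>. So \<open>x\<close> is killed by \<open>Suc n\<close> iterates, and
      \<open>triv\<close> removes the last one.\<close>
    have stable: "H \<inter> ?K (n + k) \<subseteq> ?K n" for k
    proof (induction k)
      case (Suc k)
      show ?case
      proof
        fix x assume x: "x \<in> H \<inter> ?K (n + Suc k)"
        then have "F x \<in> H \<inter> ?K (n + k)"
          using H(1,3) hom by (auto simp: kernel_def funpow_swap1 hom_def)
        with Suc have "x \<in> ?K (Suc n)"
          using x by (auto simp: kernel_def funpow_swap1)
        then show "x \<in> ?K n"
          using triv x by (auto simp: kernel_def)
      qed
    qed simp
    have "H \<subseteq> ?K n"
    proof
      fix x assume "x \<in> H"
      with H_nil obtain k where "x \<in> ?K k" by blast
      then have "x \<in> ?K (n + k)"
        using kernel_mono_funpow[OF G hom, of k "n + k"] by auto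
      with \<open>x \<in> H\<close> stable show "x \<in> ?K n" by blast
    qed
    then show False
      using finite_kernel_funpow[OF G hom fin] H(4) finite_subset by blast
  qed
  with minimal have full: "kernel G G F \<inter> S \<subseteq> (F ^^ n) ` (H \<inter> ?K (Suc n))" by blast
  interpret Fn: group_hom G G "F ^^ n"
    using funpow_hom[OF hom] by unfold_locales
  show ?case
  proof
    fix x assume x: "x \<in> ?K (Suc n) \<inter> S"
    have FS: "(F ^^ k) x \<in> S" for k
      using x SF by (induction k) auto
    have xc: "x \<in> carrier G"
      using x by (simp add: kernel_def)
    have "(F ^^ n) x \<in> kernel G G F \<inter> S"
      using x xc FS by (auto simp: kernel_def)
    \<comment> \<open>Correct \<open>x\<close> by an element \<open>y\<close> of \<open>H\<close>
      with the same \<open>n\<close>-th image: the quotient lies in \<open>?K n\<close>, where the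
      induction hypothesis applies.\<close>
    with full obtain y where y: "y \<in> H" "y \<in> carrier G" "(F ^^ n) y = (F ^^ n) x"
      by (force simp: kernel_def)
    have "x \<otimes>\<^bsub>G\<^esub> inv\<^bsub>G\<^esub> y \<in> ?K n"
      using xc y by (simp add: kernel_def)
    moreover have "x \<otimes>\<^bsub>G\<^esub> inv\<^bsub>G\<^esub> y \<in> S"
      using x y(1) H(2) S by (auto intro: subgroup.m_closed subgroup.m_inv_closed)
    ultimately have "x \<otimes>\<^bsub>G\<^esub> inv\<^bsub>G\<^esub> y \<in> H"
      using Suc.IH by blast
    then have "x \<otimes>\<^bsub>G\<^esub> inv\<^bsub>G\<^esub> y \<otimes>\<^bsub>G\<^esub> y \<in> H"
      using y(1) H(1) by (simp add: subgroup.m_closed)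
    then show "x \<in> H"
      using xc y(2) by (simp add: m_assoc)
  qed
qed

lemma shift_apply: "shift x i = x (i + 1)"
  by (simp add: shift_def)

lemma shift_injective: "shift x = shift y \<Longrightarrow> x = y"
proof
  fix i assume "shift x = shift y"
  then show "x i = y i"
    using shift_apply[of x "i - 1"] shift_apply[of y "i - 1"] by simp
qed

lemma funpow_shift_commute:
  fixes F :: "(int \<Rightarrow> 'a) \<Rightarrow> int \<Rightarrow> 'a"
  assumes "F \<circ> shift = shift \<circ> F"
  shows "(F ^^ n) (shift x) = shift ((F ^^ n) x)"
proof -
  have "F (shift y) = shift (F y)" for y
    using assms by (metis comp_apply)
  then show ?thesis
    by (induction n) simp_all
qed

text \<open>The shift is injective and fixes the identity, so it both preserves and reflects
  membership in the kernel. Reflection is what yields equality of the image rather than an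
  inclusion.\<close>

lemma shift_invariant_Int_kernel:
  assumes G: "abelian_group_shift G" and comm: "F \<circ> shift = shift \<circ> F"
    and H: "shift_invariant H"
  shows "shift_invariant (H \<inter> kernel G G (F ^^ n))"
proof -
  have uc: "carrier G = UNIV" and grp: "group G" and hom: "shift \<in> hom G G"
    using G by (auto simp: abelian_group_shift_def comm_group_def)
  have one: "shift \<one>\<^bsub>G\<^esub> = \<one>\<^bsub>G\<^esub>"
    using hom grp hom_one by blast
  have kernel_iff: "shift x \<in> kernel G G (F ^^ n) \<longleftrightarrow> x \<in> kernel G G (F ^^ n)" for x
    using shift_injective[of "(F ^^ n) x" "\<one>\<^bsub>G\<^esub>"] one
    by (auto simp: kernel_def uc funpow_shift_commute[OF comm])
  have "shift ` (H \<inter> kernel G G (F ^^ n)) = shift ` H \<inter> kernel G G (F ^^ n)"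
    using kernel_iff by blast
  then show ?thesis
    using H by (simp add: shift_invariant_def)
qed

lemma shift_invariant_funpow_image:
  fixes F :: "(int \<Rightarrow> 'a) \<Rightarrow> int \<Rightarrow> 'a"
  assumes comm: "F \<circ> shift = shift \<circ> F" and H: "shift_invariant H"
  shows "shift_invariant ((F ^^ n) ` H)"
proof -
  have "shift ` (F ^^ n) ` H = (F ^^ n) ` shift ` H"
    by (simp add: image_image funpow_shift_commute[OF comm])
  then show ?thesis
    using H by (simp add: shift_invariant_def)
qed

text \<open>Given the image, a window of \<open>s - r\<close> cells determines the next cell on the
  right by permutativity in the last argument, and on the left by permutativity in the first. The
  window thus slides over all of the integers.\<close>

lemma bipermutative_eqI:
  assumes rule: "local_rule F r s f" and rs: "r \<le> s"
    and left: "\<And>u b. length u = nat (s - r) \<Longrightarrow> \<exists>!a. f (a # u) = b"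
    and right: "\<And>u b. length u = nat (s - r) \<Longrightarrow> \<exists>!a. f (u @ [a]) = b"
    and Fxy: "F x = F y" and window: "map x [r..s - 1] = map y [r..s - 1]"
  shows "x = y"
proof -
  have F: "F z m = f (map z [m + r..m + s])" for z m
    using rule by (simp add: local_rule_def)
  have step_right: "x (m + s) = y (m + s)"
    if "map x [m + r..m + s - 1] = map y [m + r..m + s - 1]" for m
  proof -
    have F_snoc: "f (map z [m + r..m + s - 1] @ [z (m + s)]) = F z m" for z
      using rs by (simp add: F upto_rec2[of "m + r"])
    have "length (map x [m + r..m + s - 1]) = nat (s - r)" by simp
    from right[OF this, of "F x m"] show ?thesis
      using F_snoc[of x] F_snoc[of y] that Fxy by auto
  qed
  have step_left: "x (m + r) = y (m + r)"
    if "map x [m + r + 1..m + s] = map y [m + r + 1..m + s]" for m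
  proof -
    have F_Cons: "f (z (m + r) # map z [m + r + 1..m + s]) = F z m" for z
      using rs by (simp add: F upto_rec1[of "m + r"])
    have "length (map x [m + r + 1..m + s]) = nat (s - r)" by simp
    from left[OF this, of "F x m"] show ?thesis
      using F_Cons[of x] F_Cons[of y] that Fxy by auto
  qed
  have agree: "\<forall>i \<in> {m + r..m + s - 1}. x i = y i" for m
  proof (induction m rule: int_induct[of _ 0])
    case base
    show ?case using window by simp
  next
    case (step1 m)
    then have last: "x (m + s) = y (m + s)" by (intro step_right) simp
    show ?case
    proof
      fix i assume "i \<in> {m + 1 + r..m + 1 + s - 1}"
      then have "i = m + s \<or> i \<in> {m + r..m + s - 1}" by auto
      then show "x i = y i" using step1.IH last by blast
    qed
  next
    case (step2 m)
    then have first: "x (m - 1 + r) = y (m - 1 + r)" by (intro step_left) simp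
    show ?case
    proof
      fix i assume "i \<in> {m - 1 + r..m - 1 + s - 1}"
      then have "i = m - 1 + r \<or> i \<in> {m + r..m + s - 1}" by auto
      then show "x i = y i" using step2.IH first by blast
    qed
  qed
  show ?thesis
  proof
    fix i
    show "x i = y i"
      \<comment> \<open>Cell \<open>i\<close> is read off as the one just right of a window. This
        also covers \<open>r = s\<close>, where windows are empty and \<open>agree\<close> alone
        says nothing.\<close>
      using step_right[of "i - s"] agree[of "i - s"] by simp
  qed
qed

text \<open>Restriction to one window is injective on a fibre, and a finite alphabet has finitely
  many words of a given length.\<close>

lemma bipermutative_finite_fibre:
  fixes F :: "(int \<Rightarrow> 'a::finite) \<Rightarrow> int \<Rightarrow> 'a"
  assumes "bipermutative F"
  shows "finite {x. F x = z}"
proof -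
  obtain r s f where rs: "r \<le> s" and rule: "local_rule F r s f"
    and perm: "\<And>u b. length u = nat (s - r) \<Longrightarrow> \<exists>!a. f (a # u) = b"
      "\<And>u b. length u = nat (s - r) \<Longrightarrow> \<exists>!a. f (u @ [a]) = b"
    using assms unfolding bipermutative_def smallest_neighborhood_def neighborhood_def by metis
  let ?w = "\<lambda>x. map x [r..s - 1]"
  have "inj_on ?w {x. F x = z}"
    using bipermutative_eqI[OF rule rs perm] by (auto intro!: inj_onI)
  moreover have "finite (?w ` {x. F x = z})"
    by (rule finite_subset[OF _ finite_lists_length_eq[of UNIV "length [r..s - 1]"]]) auto
  ultimately show ?thesis
    using finite_imageD by blast
qed

theorem corollary4p7:
  fixes G :: "(int \<Rightarrow> 'a::finite) monoid"
    and F :: "(int \<Rightarrow> 'a) \<Rightarrow> (int \<Rightarrow> 'a)"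
    and S :: "(int \<Rightarrow> 'a) set"
  assumes "abelian_group_shift G"
    and "algebraic_CA G F"
    and "bipermutative F"
    and "subgroup S G"
    and "closedin config_topology S"
    and "F_shift_invariant F S"
    and "\<forall>\<Gamma>. subgroup \<Gamma> G \<and> shift_invariant \<Gamma> \<and> \<Gamma> \<subseteq> kernel G G F \<inter> S \<longrightarrow>
           \<Gamma> = {\<one>\<^bsub>G\<^esub>} \<or> \<Gamma> = kernel G G F \<inter> S"
  shows "\<forall>\<Gamma>. subgroup \<Gamma> G \<and> F_shift_invariant F \<Gamma> \<and> infinite \<Gamma> \<and>
           \<Gamma> \<subseteq> (\<Union>n::nat. kernel G G (F ^^ n) \<inter> S) \<longrightarrow>
           \<Gamma> = (\<Union>n::nat. kernel G G (F ^^ n) \<inter> S)"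
proof (intro allI impI)
  fix \<Gamma>
  let ?K = "\<lambda>n. kernel G G (F ^^ n)"
  assume \<Gamma>: "subgroup \<Gamma> G \<and> F_shift_invariant F \<Gamma> \<and> infinite \<Gamma> \<and> \<Gamma> \<subseteq> (\<Union>n. ?K n \<inter> S)"
  have uc: "carrier G = UNIV" and grp: "group G"
    using assms(1) by (auto simp: abelian_group_shift_def comm_group_def)
  have hom: "F \<in> hom G G" and comm: "F \<circ> shift = shift \<circ> F"
    using assms(2) by (auto simp: algebraic_CA_def cellular_automaton_def)
  have \<Gamma>_sub: "subgroup \<Gamma> G" and \<Gamma>_S: "\<Gamma> \<subseteq> S" and \<Gamma>_F: "F ` \<Gamma> \<subseteq> \<Gamma>"
    and \<Gamma>_shift: "shift_invariant \<Gamma>"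
    using \<Gamma> by (auto simp: F_shift_invariant_def)
  have "?K n \<inter> S \<subseteq> \<Gamma>" for n
  proof (rule kernel_funpow_subset[OF grp hom _ assms(4)])
    fix n
    let ?C = "(F ^^ n) ` (\<Gamma> \<inter> ?K (Suc n))"
    have homs: "group_hom G G (F ^^ k)" for k
      using grp funpow_hom[OF hom] by (simp add: group_hom_def group_hom_axioms_def)
    have "subgroup (\<Gamma> \<inter> ?K (Suc n)) G"
      using \<Gamma>_sub group_hom.subgroup_kernel[OF homs] grp by (blast intro: group.subgroups_Inter_pair)
    then have "subgroup ?C G"
      using group_hom.subgroup_img_is_subgroup[OF homs] by blast
    moreover have "shift_invariant ?C"
      by (intro shift_invariant_funpow_image shift_invariant_Int_kernel assms(1) comm \<Gamma>_shift)
    moreover have "(F ^^ k) x \<in> \<Gamma>" if "x \<in> \<Gamma>" for k x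
      using that \<Gamma>_F by (induction k) auto
    \<comment> \<open>One more application of \<open>F\<close> to an element of \<open>?C\<close>
      completes \<open>Suc n\<close> iterates on an element of \<open>?K (Suc n)\<close>, giving the
      identity.\<close>
    then have "?C \<subseteq> kernel G G F \<inter> S"
      using \<Gamma>_S by (auto simp: kernel_def uc)
    ultimately show "?C \<subseteq> {\<one>\<^bsub>G\<^esub>} \<or> kernel G G F \<inter> S \<subseteq> ?C"
      using assms(7) by blast
  qed (use \<Gamma> \<Gamma>_S assms(6) bipermutative_finite_fibre[OF assms(3)] in
      \<open>auto simp: uc F_shift_invariant_def\<close>)
  then show "\<Gamma> = (\<Union>n. ?K n \<inter> S)"
    using \<Gamma> by blast
qed

end
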